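(* Let $K\subseteq\mathbb{R}^{n+m}$ be a compact set that is partially convex in $x$, and let $z\in\mathbb{R}^{n+m}$ with $z\notin K$. Then there exists $p\in\mathcal{P}_{\mathrm{aff}}(K)$ such that $p(w)\ge 0$ for all $w\in K$ and $p(z)<0$.
   Context: Elements of $\mathbb{R}^{n+m}$ are written $(x,y)$ with $x\in\mathbb{R}^n$, $y\in\mathbb{R}^m$. A set $K\subseteq\mathbb{R}^{n+m}$ is partially convex in $x$ if for every $y_0\in\pi_2(K)=\{y\in\mathbb{R}^m:\exists x,\ (x,y)\in K\}$ the slice $K_{y_0}=\{x\in\mathbb{R}^n:(x,y_0)\in K\}$ is convex. $\mathcal{P}_{\mathrm{aff}}(K)$ is the space of partially affine polynomials, i.e. real polynomials $p(x,y)$ such that for any fixed $y_0$ the function $x\mapsto p(x,y_0)$ is affine; equivalently $p(x,y)=\sum_{i=1}^n c_i(y)x_i+c_0(y)$ with $c_0,\dots,c_n$ real polynomials in $y$. *)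

theory Defs
  imports "HOL-Analysis.Analysis"
begin

text \<open>
  Points of R^(n+m), written (x, y) with x in R^n and y in R^m, are rendered as elements of the
  product type; the two index types have n and m elements.
\<close>

definition slice :: "((real ^ 'n) \<times> (real ^ 'm)) set \<Rightarrow> real ^ 'm \<Rightarrow> (real ^ 'n) set" where
  "slice K y = {x. (x, y) \<in> K}"

definition partially_convex :: "((real ^ 'n) \<times> (real ^ 'm)) set \<Rightarrow> bool" where
  "partially_convex K \<longleftrightarrow> (\<forall>y \<in> snd ` K. convex (slice K y))"

definition affine_function :: "('a::real_vector \<Rightarrow> real) \<Rightarrow> bool" where
  "affine_function f \<longleftrightarrow> (\<exists>g c. linear g \<and> f = (\<lambda>x. g x + c))"

text \<open>
  The real field is infinite, so real polynomials are identified with the functions they induce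
  on the whole space. Neither the polynomials nor the condition of being affine for fixed y are
  restricted to a set K, hence the space does not depend on K.
\<close>

definition partially_affine_polynomials :: "((real ^ 'n) \<times> (real ^ 'm) \<Rightarrow> real) set" where
  "partially_affine_polynomials =
     {p. real_polynomial_function p \<and> (\<forall>y. affine_function (\<lambda>x. p (x, y)))}"

end

theory Submission
  imports Defs
begin

text \<open>
  Let \<open>z = (x\<^sub>0, y\<^sub>0)\<close>. A hyperplane in \<open>x\<close>-space separates \<open>x\<^sub>0\<close> strictly from the compact convex
  slice of \<open>K\<close> over \<open>y\<^sub>0\<close>, so there is an affine function \<open>g\<close> of \<open>x\<close> alone which is negative at \<open>x\<^sub>0\<close>
  and positive on the slice. Away from the slice \<open>g\<close> may well be negative on \<open>K\<close>. It is repaired by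
  the penalty \<open>M * \<bar>y - y\<^sub>0\<bar>\<^sup>2\<close>: this is a polynomial in \<open>y\<close>, so it does not disturb affineness in \<open>x\<close>,
  and it vanishes at \<open>z\<close>, so the value there stays negative. The part of \<open>K\<close> where \<open>g \<le> 0\<close> is
  compact and misses the fibre over \<open>y\<^sub>0\<close>, hence the penalty is bounded away from \<open>0\<close> on it and a
  large enough \<open>M\<close> exists (\<open>penalty_dominates_on_compact\<close>). The coefficients of \<open>x\<close> in the
  resulting polynomial are even constant.
\<close>

text \<open>
  On the compact set where \<open>g \<le> 0\<close> the penalty \<open>q\<close> is positive, so \<open>g / q\<close> is bounded
  below there by some \<open>- M\<close>. Taking \<open>M > 0\<close> keeps the points where \<open>g\<close> is already positive harmless.
\<close>

lemma penalty_dominates_on_compact: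
  fixes g q :: "'a::topological_space \<Rightarrow> real"
  assumes K: "compact K" and g: "continuous_on K g" and q: "continuous_on K q"
    and nonneg: "\<And>w. w \<in> K \<Longrightarrow> 0 \<le> q w"
    and pos: "\<And>w. w \<in> K \<Longrightarrow> q w = 0 \<Longrightarrow> 0 < g w"
  shows "\<exists>M. \<forall>w\<in>K. 0 \<le> g w + M * q w"
proof -
  define C where "C = {w \<in> K. g w \<le> 0}"
  have q_pos: "q w > 0" if "w \<in> C" for w
    using that nonneg[of w] pos[of w] by (force simp: C_def)
  obtain A where A: "closed A" "A \<inter> K = g -` {..0} \<inter> K"
    using g by (auto simp: continuous_on_closed_invariant)
  then have "C = K \<inter> A"
    by (auto simp: C_def)
  then have "compact C"
    using K A(1) by (simp add: compact_Int_closed)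
  moreover have "continuous_on C (\<lambda>w. g w / q w)"
  proof (intro continuous_intros continuous_on_subset[OF g] continuous_on_subset[OF q])
    show "\<forall>w\<in>C. q w \<noteq> 0"
      using q_pos by force
  qed (auto simp: C_def)
  ultimately have "bounded ((\<lambda>w. g w / q w) ` C)"
    by (intro compact_imp_bounded compact_continuous_image)
  then obtain M where M: "M > 0" "\<And>w. w \<in> C \<Longrightarrow> \<bar>g w / q w\<bar> \<le> M"
    by (auto simp: bounded_pos)
  have "0 \<le> g w + M * q w" if "w \<in> K" for w
  proof (cases "g w \<le> 0")
    case True
    then have "w \<in> C"
      using that by (simp add: C_def)
    then have "- M \<le> g w / q w" "0 < q w"
      using abs_le_D2[OF M(2)] q_pos by force+
    then show ?thesis
      by (simp add: field_simps)
  next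
    case False
    then show ?thesis
      using M(1) nonneg[OF that] by simp
  qed
  then show ?thesis
    by blast
qed

lemma partially_convex_imp_convex_slice:
  assumes "partially_convex K"
  shows "convex (slice K y)"
proof (cases "y \<in> snd ` K")
  case True
  then show ?thesis
    using assms unfolding partially_convex_def by blast
next
  case False
  then have "slice K y = {}"
    by (force simp: slice_def)
  then show ?thesis
    by simp
qed

lemma closed_slice:
  assumes "closed K"
  shows "closed (slice K y)"
proof -
  have "slice K y = (\<lambda>x. (x, y)) -` K"
    by (auto simp: slice_def)
  then show ?thesis
    using assms by (auto intro!: closed_vimage continuous_intros)
qed

lemma affine_plus_penalty_partially_affine:
  fixes a :: "real ^ 'n" and y0 :: "real ^ 'm"
  shows "(\<lambda>w. a \<bullet> fst w - b + M * (norm (snd w - y0))\<^sup>2) \<in> partially_affine_polynomials"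
proof -
  let ?p = "\<lambda>w :: (real ^ 'n) \<times> (real ^ 'm). a \<bullet> fst w - b + M * (norm (snd w - y0))\<^sup>2"
  have lin: "real_polynomial_function (\<lambda>w :: (real ^ 'n) \<times> (real ^ 'm). a \<bullet> fst w)"
    by (intro real_polynomial_function.intros(1) bounded_linear_intros)
  have coord: "real_polynomial_function (\<lambda>w :: (real ^ 'n) \<times> (real ^ 'm). snd w \<bullet> i)" for i
    by (intro real_polynomial_function.intros(1) bounded_linear_intros)
  have "(norm (y - y0))\<^sup>2 = (\<Sum>i\<in>Basis. (y \<bullet> i - y0 \<bullet> i)\<^sup>2)" for y
    unfolding power2_norm_eq_inner
    by (subst euclidean_inner) (simp add: inner_diff_left power2_eq_square)
  then have "real_polynomial_function (\<lambda>w :: (real ^ 'n) \<times> (real ^ 'm). (norm (snd w - y0))\<^sup>2)"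
    by (simp only:) (intro real_polynomial_function_sum real_polynomial_function_power
      real_polynomial_function_diff coord real_polynomial_function.intros(2) finite_Basis)
  then have "real_polynomial_function ?p"
    by (intro real_polynomial_function.intros(2-4) real_polynomial_function_diff lin)
  moreover have "affine_function (\<lambda>x. ?p (x, y))" for y
    unfolding affine_function_def
    by (intro exI[of _ "\<lambda>x. a \<bullet> x"] exI[of _ "- b + M * (norm (y - y0))\<^sup>2"])
      (auto intro!: bounded_linear.linear bounded_linear_intros)
  ultimately show ?thesis
    by (simp add: partially_affine_polynomials_def)
qed

theorem theorem2p5:
  fixes K :: "((real ^ 'n) \<times> (real ^ 'm)) set"
    and z :: "(real ^ 'n) \<times> (real ^ 'm)"
  assumes "compact K"
    and "partially_convex K"
    and "z \<notin> K"
  shows "\<exists>p \<in> partially_affine_polynomials. (\<forall>w \<in> K. p w \<ge> 0) \<and> p z < 0"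
proof -
  obtain x0 y0 where z: "z = (x0, y0)"
    by (cases z)
  have "x0 \<notin> slice K y0"
    using assms(3) by (simp add: z slice_def)
  then obtain a b where ab: "a \<bullet> x0 < b" "\<And>x. x \<in> slice K y0 \<Longrightarrow> b < a \<bullet> x"
    using separating_hyperplane_closed_point[of "slice K y0" x0]
      partially_convex_imp_convex_slice[OF assms(2)] closed_slice[OF compact_imp_closed[OF assms(1)]]
    by metis
  have "\<exists>M. \<forall>w\<in>K. 0 \<le> (a \<bullet> fst w - b) + M * (norm (snd w - y0))\<^sup>2"
  proof (rule penalty_dominates_on_compact[OF assms(1)])
    show "0 < a \<bullet> fst w - b" if "w \<in> K" "(norm (snd w - y0))\<^sup>2 = 0" for w
      using that ab(2)[of "fst w"] by (cases w) (auto simp: slice_def)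
  qed (auto intro!: continuous_intros)
  then obtain M where "\<forall>w\<in>K. 0 \<le> a \<bullet> fst w - b + M * (norm (snd w - y0))\<^sup>2"
    by blast
  then show ?thesis
    using affine_plus_penalty_partially_affine[of a b M y0] ab(1)
    by (intro bexI[of _ "\<lambda>w. a \<bullet> fst w - b + M * (norm (snd w - y0))\<^sup>2"]) (auto simp: z)
qed

end
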